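(* Let $n\ge 1$, and let $M$ and $N$ be interval decomposable $\mathbb R^n$-indexed modules. If there exists an $\epsilon$-matching between $\mathcal B(M)$ and $\mathcal B(N)$, then $M$ and $N$ are $\epsilon$-interleaved. In particular, $d_I(M,N)\le d_b(\mathcal B(M),\mathcal B(N))$.
   Context: Fix a field $k$. $\mathbb R^n$ has the product partial order. An $\mathbb R^n$-indexed module is a functor $M:\mathbb R^n\to\mathrm{Vec}_k$, with internal maps $\varphi_M(a,b):M_a\to M_b$ for $a\le b$. An interval of $\mathbb R^n$ is a nonempty subset $\mathcal J$ that is convex ($a\le b\le c$, $a,c\in\mathcal J\Rightarrow b\in\mathcal J$) and connected (any two elements are joined by a finite sequence in $\mathcal J$ of consecutively comparable elements). $I^{\mathcal J}$ is the module equal to $k$ on $\mathcal J$ and $0$ elsewhere, with identity maps between points of $\mathcal J$ and zero maps otherwise. $M$ is interval decomposable if $M\cong\bigoplus_{\mathcal J\in\mathcal B(M)}I^{\mathcal J}$ for a (possibly infinite) multiset $\mathcal B(M)$ of intervals; $\mathcal B(M)$ is then unique and is called the barcode of $M$. For $\epsilon\ge0$, $M(\epsilon)$ is the shift $M(\epsilon)_a=M_{a+\epsilon(1,\dots,1)}$, and $\varphi_M^\epsilon:M\to M(\epsilon)$ is given by internal maps. $M,N$ are $\epsilon$-interleaved if there are morphisms $f:M\to N(\epsilon)$ and $g:N\to M(\epsilon)$ with $g(\epsilon)\circ f=\varphi_M^{2\epsilon}$ and $f(\epsilon)\circ g=\varphi_N^{2\epsilon}$. $d_I(M,N)=\inf\{\epsilon\ge0: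 M,N\text{ are }\epsilon\text{-interleaved}\}$. $M$ is $\epsilon$-trivial if $\varphi^\epsilon_M=0$. Intervals $\mathcal J,\mathcal K$ are $\epsilon$-interleaved (resp. $\mathcal J$ is $\epsilon$-trivial) if $I^{\mathcal J},I^{\mathcal K}$ are (resp. $I^{\mathcal J}$ is). For a multiset $\mathcal C$ of intervals, $\mathcal C_\epsilon$ is the sub-multiset of intervals that are not $\epsilon$-trivial. A matching $\sigma:S\nrightarrow T$ of multisets is a bijection from a sub-multiset $\mathrm{coim}\,\sigma\subseteq S$ to a sub-multiset $\mathrm{im}\,\sigma\subseteq T$. An $\epsilon$-matching between barcodes $\mathcal C,\mathcal D$ is a matching $\sigma:\mathcal C\nrightarrow\mathcal D$ with $\mathcal C_{2\epsilon}\subseteq\mathrm{coim}\,\sigma$, $\mathcal D_{2\epsilon}\subseteq\mathrm{im}\,\sigma$, and $\mathcal J,\mathcal K$ $\epsilon$-interleaved whenever $\sigma(\mathcal J)=\mathcal K$. $d_b(\mathcal C,\mathcal D)$ is the infimum of $\epsilon\ge 0$ for which an $\epsilon$-matching exists. *)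

theory Defs
  imports "HOL-Analysis.Analysis" "HOL-Algebra.Module"
begin

section \<open>Modules indexed by \<open>\<real>\<^sup>n\<close>\<close>

text \<open>
  The field \<open>k\<close> is a ring record \<open>K\<close> with \<open>field K\<close>, and a \<open>K\<close>-vector space is a module over \<open>K\<close>
  in the sense of HOL-Algebra.  The multiplicative fields \<open>mult\<close> and \<open>one\<close> of a module
  record play no role.  The type \<open>real ^ 'n\<close> carries the product order, and its element \<open>1\<close> is
  the vector \<open>(1, \<dots>, 1)\<close>.
\<close>

record ('n, 'k, 'v) pmod =
  pt :: "real ^ 'n \<Rightarrow> ('k, 'v) module"
  imap :: "real ^ 'n \<Rightarrow> real ^ 'n \<Rightarrow> 'v \<Rightarrow> 'v"

definition linear_maps ::
  "('k, 'm) ring_scheme \<Rightarrow> ('k, 'v) module \<Rightarrow> ('k, 'w) module \<Rightarrow> ('v \<Rightarrow> 'w) set" where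
  "linear_maps K V W = {f. f \<in> carrier V \<rightarrow> carrier W
     \<and> (\<forall>x\<in>carrier V. \<forall>y\<in>carrier V. f (x \<oplus>\<^bsub>V\<^esub> y) = f x \<oplus>\<^bsub>W\<^esub> f y)
     \<and> (\<forall>c\<in>carrier K. \<forall>x\<in>carrier V. f (c \<odot>\<^bsub>V\<^esub> x) = c \<odot>\<^bsub>W\<^esub> f x)}"

text \<open>
  Functors from the poset \<open>\<real>\<^sup>n\<close> to vector spaces.  Only the values of \<open>imap M a b\<close> with \<open>a \<le> b\<close>
  on \<open>carrier (pt M a)\<close> are meaningful; accordingly all equations between maps below are
  equations on carriers.
\<close>

definition indexed_module ::
  "('k, 'm) ring_scheme \<Rightarrow> ('n::finite, 'k, 'v) pmod \<Rightarrow> bool" where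
  "indexed_module K M \<longleftrightarrow>
     (\<forall>a. Module.module K (pt M a)) \<and>
     (\<forall>a b. a \<le> b \<longrightarrow> imap M a b \<in> linear_maps K (pt M a) (pt M b)) \<and>
     (\<forall>a. \<forall>x\<in>carrier (pt M a). imap M a a x = x) \<and>
     (\<forall>a b c. a \<le> b \<longrightarrow> b \<le> c \<longrightarrow>
        (\<forall>x\<in>carrier (pt M a). imap M b c (imap M a b x) = imap M a c x))"

definition morphism ::
  "('k, 'm) ring_scheme \<Rightarrow> ('n::finite, 'k, 'v) pmod \<Rightarrow> ('n, 'k, 'w) pmod \<Rightarrow>
     (real ^ 'n \<Rightarrow> 'v \<Rightarrow> 'w) \<Rightarrow> bool" where
  "morphism K M N f \<longleftrightarrow>
     (\<forall>a. f a \<in> linear_maps K (pt M a) (pt N a)) \<and>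
     (\<forall>a b. a \<le> b \<longrightarrow> (\<forall>x\<in>carrier (pt M a). f b (imap M a b x) = imap N a b (f a x)))"

definition isomorphic ::
  "('k, 'm) ring_scheme \<Rightarrow> ('n::finite, 'k, 'v) pmod \<Rightarrow> ('n, 'k, 'w) pmod \<Rightarrow> bool" where
  "isomorphic K M N \<longleftrightarrow> (\<exists>f g. morphism K M N f \<and> morphism K N M g \<and>
     (\<forall>a. \<forall>x\<in>carrier (pt M a). g a (f a x) = x) \<and>
     (\<forall>a. \<forall>y\<in>carrier (pt N a). f a (g a y) = y))"

section \<open>Shifts and interleavings\<close>

definition shift :: "real \<Rightarrow> ('n::finite, 'k, 'v) pmod \<Rightarrow> ('n, 'k, 'v) pmod" where
  "shift \<epsilon> M = \<lparr>pt = (\<lambda>a. pt M (a + \<epsilon> *\<^sub>R 1)),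
                 imap = (\<lambda>a b. imap M (a + \<epsilon> *\<^sub>R 1) (b + \<epsilon> *\<^sub>R 1))\<rparr>"

definition shift_morphism ::
  "real \<Rightarrow> (real ^ 'n::finite \<Rightarrow> 'v \<Rightarrow> 'w) \<Rightarrow> (real ^ 'n \<Rightarrow> 'v \<Rightarrow> 'w)" where
  "shift_morphism \<epsilon> f = (\<lambda>a. f (a + \<epsilon> *\<^sub>R 1))"

text \<open>The morphism \<open>\<phi>\<^sub>M\<^sup>\<epsilon>\<close> from \<open>M\<close> to \<open>M(\<epsilon>)\<close>.\<close>

definition internal_shift ::
  "real \<Rightarrow> ('n::finite, 'k, 'v) pmod \<Rightarrow> (real ^ 'n \<Rightarrow> 'v \<Rightarrow> 'v)" where
  "internal_shift \<epsilon> M = (\<lambda>a. imap M a (a + \<epsilon> *\<^sub>R 1))"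

definition interleaved ::
  "('k, 'm) ring_scheme \<Rightarrow> real \<Rightarrow> ('n::finite, 'k, 'v) pmod \<Rightarrow> ('n, 'k, 'w) pmod \<Rightarrow> bool" where
  "interleaved K \<epsilon> M N \<longleftrightarrow> (\<exists>f g. morphism K M (shift \<epsilon> N) f \<and> morphism K N (shift \<epsilon> M) g \<and>
     (\<forall>a. \<forall>x\<in>carrier (pt M a). shift_morphism \<epsilon> g a (f a x) = internal_shift (2 * \<epsilon>) M a x) \<and>
     (\<forall>a. \<forall>y\<in>carrier (pt N a). shift_morphism \<epsilon> f a (g a y) = internal_shift (2 * \<epsilon>) N a y))"

text \<open>Distances are extended reals; the infimum of the empty set is \<open>\<infinity>\<close>.\<close>

definition interleaving_distance ::
  "('k, 'm) ring_scheme \<Rightarrow> ('n::finite, 'k, 'v) pmod \<Rightarrow> ('n, 'k, 'w) pmod \<Rightarrow> ereal" where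
  "interleaving_distance K M N = (INF \<epsilon>\<in>{\<epsilon>. 0 \<le> \<epsilon> \<and> interleaved K \<epsilon> M N}. ereal \<epsilon>)"

definition trivial_module :: "real \<Rightarrow> ('n::finite, 'k, 'v) pmod \<Rightarrow> bool" where
  "trivial_module \<epsilon> M \<longleftrightarrow>
     (\<forall>a. \<forall>x\<in>carrier (pt M a). internal_shift \<epsilon> M a x = \<zero>\<^bsub>pt M (a + \<epsilon> *\<^sub>R 1)\<^esub>)"

section \<open>Intervals and interval modules\<close>

definition poset_convex :: "'p::order set \<Rightarrow> bool" where
  "poset_convex J \<longleftrightarrow> (\<forall>a\<in>J. \<forall>c\<in>J. \<forall>b. a \<le> b \<and> b \<le> c \<longrightarrow> b \<in> J)"

definition poset_connected :: "'p::order set \<Rightarrow> bool" where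
  "poset_connected J \<longleftrightarrow>
     (\<forall>a\<in>J. \<forall>b\<in>J. (a, b) \<in> {(x, y). x \<in> J \<and> y \<in> J \<and> (x \<le> y \<or> y \<le> x)}\<^sup>*)"

definition poset_interval :: "'p::order set \<Rightarrow> bool" where
  "poset_interval J \<longleftrightarrow> J \<noteq> {} \<and> poset_convex J \<and> poset_connected J"

definition interval_module ::
  "('k, 'm) ring_scheme \<Rightarrow> (real ^ 'n::finite) set \<Rightarrow> ('n, 'k, 'k) pmod" where
  "interval_module K J = \<lparr>
     pt = (\<lambda>a. \<lparr>carrier = (if a \<in> J then carrier K else {\<zero>\<^bsub>K\<^esub>}),
                mult = mult K, one = one K, zero = zero K, add = add K, smult = mult K\<rparr>),
     imap = (\<lambda>a b x. if a \<in> J \<and> b \<in> J then x else \<zero>\<^bsub>K\<^esub>)\<rparr>"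

definition direct_sum_space :: "'i set \<Rightarrow> ('i \<Rightarrow> ('k, 'v) module) \<Rightarrow> ('k, 'i \<Rightarrow> 'v) module" where
  "direct_sum_space I V = \<lparr>
     carrier = {x \<in> (\<Pi>\<^sub>E i\<in>I. carrier (V i)). finite {i \<in> I. x i \<noteq> \<zero>\<^bsub>V i\<^esub>}},
     mult = undefined, one = undefined,
     zero = (\<lambda>i\<in>I. \<zero>\<^bsub>V i\<^esub>),
     add = (\<lambda>x y. \<lambda>i\<in>I. x i \<oplus>\<^bsub>V i\<^esub> y i),
     smult = (\<lambda>c x. \<lambda>i\<in>I. c \<odot>\<^bsub>V i\<^esub> x i)\<rparr>"

definition direct_sum ::
  "'i set \<Rightarrow> ('i \<Rightarrow> ('n::finite, 'k, 'v) pmod) \<Rightarrow> ('n, 'k, 'i \<Rightarrow> 'v) pmod" where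
  "direct_sum I F = \<lparr>
     pt = (\<lambda>a. direct_sum_space I (\<lambda>i. pt (F i) a)),
     imap = (\<lambda>a b x. \<lambda>i\<in>I. imap (F i) a b (x i))\<rparr>"

section \<open>Barcodes\<close>

text \<open>
  Multisets of intervals may be infinite, with infinite multiplicities, so they are represented as
  families of sets: each \<open>i \<in> idx C\<close> contributes one copy of the set \<open>bar C i\<close>.  Reindexing a
  family along a bijection gives the same multiset.
\<close>

record ('i, 'p) set_multiset =
  idx :: "'i set"
  bar :: "'i \<Rightarrow> 'p set"

text \<open>
  \<open>has_barcode K M C\<close>: \<open>M\<close> is interval decomposable and \<open>C\<close> is (a family representing) its
  barcode.
\<close>

definition has_barcode ::
  "('k, 'm) ring_scheme \<Rightarrow> ('n::finite, 'k, 'v) pmod \<Rightarrow> ('i, real ^ 'n) set_multiset \<Rightarrow> bool" where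
  "has_barcode K M C \<longleftrightarrow>
     (\<forall>i\<in>idx C. poset_interval (bar C i)) \<and>
     isomorphic K M (direct_sum (idx C) (\<lambda>i. interval_module K (bar C i)))"

text \<open>The sub-multiset \<open>C\<^sub>\<epsilon>\<close>, as a set of indices.\<close>

definition nontrivial_idx ::
  "('k, 'm) ring_scheme \<Rightarrow> real \<Rightarrow> ('i, real ^ 'n::finite) set_multiset \<Rightarrow> 'i set" where
  "nontrivial_idx K \<epsilon> C = {i \<in> idx C. \<not> trivial_module \<epsilon> (interval_module K (bar C i))}"

text \<open>A matching is a partial injection on indices, with coimage \<open>dom \<sigma>\<close> and image \<open>ran \<sigma>\<close>.\<close>

definition matching ::
  "('i, 'p) set_multiset \<Rightarrow> ('j, 'p) set_multiset \<Rightarrow> ('i \<rightharpoonup> 'j) \<Rightarrow> bool" where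
  "matching C D \<sigma> \<longleftrightarrow> dom \<sigma> \<subseteq> idx C \<and> ran \<sigma> \<subseteq> idx D \<and> inj_on \<sigma> (dom \<sigma>)"

definition eps_matching ::
  "('k, 'm) ring_scheme \<Rightarrow> real \<Rightarrow> ('i, real ^ 'n::finite) set_multiset \<Rightarrow>
     ('j, real ^ 'n) set_multiset \<Rightarrow> ('i \<rightharpoonup> 'j) \<Rightarrow> bool" where
  "eps_matching K \<epsilon> C D \<sigma> \<longleftrightarrow> matching C D \<sigma> \<and>
     nontrivial_idx K (2 * \<epsilon>) C \<subseteq> dom \<sigma> \<and>
     nontrivial_idx K (2 * \<epsilon>) D \<subseteq> ran \<sigma> \<and>
     (\<forall>i j. \<sigma> i = Some j \<longrightarrow>
        interleaved K \<epsilon> (interval_module K (bar C i)) (interval_module K (bar D j)))"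

definition bottleneck_distance ::
  "('k, 'm) ring_scheme \<Rightarrow> ('i, real ^ 'n::finite) set_multiset \<Rightarrow>
     ('j, real ^ 'n) set_multiset \<Rightarrow> ereal" where
  "bottleneck_distance K C D = (INF \<epsilon>\<in>{\<epsilon>. 0 \<le> \<epsilon> \<and> (\<exists>\<sigma>. eps_matching K \<epsilon> C D \<sigma>)}. ereal \<epsilon>)"

end

theory Submission
  imports Defs
begin

text \<open>
  An interleaving is a pair of morphisms, and morphisms between direct sums can be built summand by
  summand.  On matched pairs of summands use the given interleaving morphisms, and let everything
  else be zero.  The composites are the internal shifts: on a matched summand by assumption, and on
  an unmatched one because the internal shift by \<open>2\<epsilon>\<close> vanishes there.
\<close>

section \<open>Linear maps and morphisms\<close>

text \<open>\<open>linear_maps\<close> asks only for additivity and homogeneity, so zero has to be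
  recovered by cancelling in \<open>f 0 + f 0 = f 0\<close>. Direct sums rely on this: zero fills
  every unmatched coordinate and defines the support.\<close>

lemma linear_maps_zero:
  assumes "Module.module K V" "Module.module K W" "f \<in> linear_maps K V W"
  shows "f \<zero>\<^bsub>V\<^esub> = \<zero>\<^bsub>W\<^esub>"
proof -
  interpret V: Module.module K V by fact
  interpret W: Module.module K W by fact
  have fz: "f \<zero>\<^bsub>V\<^esub> \<in> carrier W"
    using assms(3) by (auto simp: linear_maps_def)
  have "f (\<zero>\<^bsub>V\<^esub> \<oplus>\<^bsub>V\<^esub> \<zero>\<^bsub>V\<^esub>) = f \<zero>\<^bsub>V\<^esub> \<oplus>\<^bsub>W\<^esub> f \<zero>\<^bsub>V\<^esub>"
    using assms(3) V.zero_closed unfolding linear_maps_def by blast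
  then have "f \<zero>\<^bsub>V\<^esub> \<oplus>\<^bsub>W\<^esub> f \<zero>\<^bsub>V\<^esub> = f \<zero>\<^bsub>V\<^esub>"
    by simp
  then show ?thesis
    using fz W.add.l_cancel_one by blast
qed

lemma linear_maps_closed: "f \<in> linear_maps K V W \<Longrightarrow> x \<in> carrier V \<Longrightarrow> f x \<in> carrier W"
  by (auto simp: linear_maps_def)

lemma linear_maps_add:
  "f \<in> linear_maps K V W \<Longrightarrow> x \<in> carrier V \<Longrightarrow> y \<in> carrier V \<Longrightarrow>
     f (x \<oplus>\<^bsub>V\<^esub> y) = f x \<oplus>\<^bsub>W\<^esub> f y"
  by (auto simp: linear_maps_def)

lemma linear_maps_smult:
  "f \<in> linear_maps K V W \<Longrightarrow> c \<in> carrier K \<Longrightarrow> x \<in> carrier V \<Longrightarrow>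
     f (c \<odot>\<^bsub>V\<^esub> x) = c \<odot>\<^bsub>W\<^esub> f x"
  by (auto simp: linear_maps_def)

lemma linear_maps_comp:
  "f \<in> linear_maps K U V \<Longrightarrow> g \<in> linear_maps K V W \<Longrightarrow> (\<lambda>x. g (f x)) \<in> linear_maps K U W"
  by (auto simp: linear_maps_def Pi_iff)

lemma morphism_linear: "morphism K M N f \<Longrightarrow> f a \<in> linear_maps K (pt M a) (pt N a)"
  by (auto simp: morphism_def)

lemma morphism_natural:
  "morphism K M N f \<Longrightarrow> a \<le> b \<Longrightarrow> x \<in> carrier (pt M a) \<Longrightarrow>
     f b (imap M a b x) = imap N a b (f a x)"
  by (auto simp: morphism_def)

lemmas morphism_closed = linear_maps_closed[OF morphism_linear]

lemma morphism_comp: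
  assumes "morphism K M N f" "morphism K N P g"
  shows "morphism K M P (\<lambda>a x. g a (f a x))"
  using assms linear_maps_comp[OF morphism_linear[OF assms(1)] morphism_linear[OF assms(2)]]
    morphism_closed[OF assms(1)]
  by (simp add: morphism_def)

section \<open>Arithmetic of diagonal shifts\<close>

lemma le_add_scaleR_1: "0 \<le> (\<epsilon>::real) \<Longrightarrow> (a::real ^ 'n::finite) \<le> a + \<epsilon> *\<^sub>R 1"
  by (simp add: less_eq_vec_def)

text \<open>The composite of two morphisms of degree \<epsilon> lands at the left-hand index,
  \<open>internal_shift (2 * \<epsilon>)\<close> at the right-hand one.\<close>

lemma add_scaleR_1_twice:
  "(a::real ^ 'n::finite) + \<epsilon> *\<^sub>R 1 + \<epsilon> *\<^sub>R 1 = a + (2 * \<epsilon>) *\<^sub>R 1"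
  by (simp add: vec_eq_iff)

lemma pt_shift [simp]: "pt (shift \<epsilon> M) a = pt M (a + \<epsilon> *\<^sub>R 1)"
  and imap_shift [simp]: "imap (shift \<epsilon> M) a b = imap M (a + \<epsilon> *\<^sub>R 1) (b + \<epsilon> *\<^sub>R 1)"
  by (simp_all add: shift_def)

lemma morphism_shift:
  "morphism K M N f \<Longrightarrow> morphism K (shift \<epsilon> M) (shift \<epsilon> N) (shift_morphism \<epsilon> f)"
  by (simp add: morphism_def shift_morphism_def)

lemma indexed_module_shift: "indexed_module K M \<Longrightarrow> indexed_module K (shift \<epsilon> M)"
  by (auto simp: indexed_module_def)

section \<open>Interleavings and isomorphisms\<close>

lemma interleaved_sym: "interleaved K \<epsilon> M N \<Longrightarrow> interleaved K \<epsilon> N M"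
  unfolding interleaved_def by blast

text \<open>Precompose \<open>f\<close> with the isomorphism \<open>M\<close> to \<open>M'\<close>
  and postcompose \<open>g\<close> with the shift of its inverse.\<close>

lemma interleaved_isomorphic_left:
  assumes "0 \<le> \<epsilon>" "isomorphic K M M'" "interleaved K \<epsilon> M' N"
  shows "interleaved K \<epsilon> M N"
proof -
  obtain p q where p: "morphism K M M' p" and q: "morphism K M' M q"
    and qp: "\<And>a x. x \<in> carrier (pt M a) \<Longrightarrow> q a (p a x) = x"
    and pq: "\<And>a y. y \<in> carrier (pt M' a) \<Longrightarrow> p a (q a y) = y"
    using assms(2) unfolding isomorphic_def by blast
  obtain f g where f: "morphism K M' (shift \<epsilon> N) f" and g: "morphism K N (shift \<epsilon> M') g"
    and gf: "\<And>a x. x \<in> carrier (pt M' a) \<Longrightarrow>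
      g (a + \<epsilon> *\<^sub>R 1) (f a x) = imap M' a (a + (2 * \<epsilon>) *\<^sub>R 1) x"
    and fg: "\<And>a y. y \<in> carrier (pt N a) \<Longrightarrow>
      f (a + \<epsilon> *\<^sub>R 1) (g a y) = imap N a (a + (2 * \<epsilon>) *\<^sub>R 1) y"
    using assms(3) unfolding interleaved_def shift_morphism_def internal_shift_def by blast
  let ?f = "\<lambda>a x. f a (p a x)" and ?g = "\<lambda>a y. shift_morphism \<epsilon> q a (g a y)"
  have "morphism K M (shift \<epsilon> N) ?f"
    by (rule morphism_comp[OF p f])
  moreover have "morphism K N (shift \<epsilon> M) ?g"
    by (rule morphism_comp[OF g morphism_shift[OF q]])
  moreover have "shift_morphism \<epsilon> ?g a (?f a x) = internal_shift (2 * \<epsilon>) M a x"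
    if x: "x \<in> carrier (pt M a)" for a x
  proof -
    have le: "a \<le> a + (2 * \<epsilon>) *\<^sub>R 1"
      using assms(1) by (intro le_add_scaleR_1) simp
    \<comment> \<open>Naturality of \<open>q\<close> along \<open>le\<close> pulls the internal map
      of \<open>M'\<close> back to \<open>M\<close>, where \<open>q\<close> and \<open>p\<close>
      cancel.\<close>
    show ?thesis
      using morphism_natural[OF q le morphism_closed[OF p x]]
      by (simp add: shift_morphism_def internal_shift_def add_scaleR_1_twice
          gf[OF morphism_closed[OF p x]] qp[OF x])
  qed
  \<comment> \<open>Here \<open>p\<close> and \<open>q\<close> meet in the middle of the composite
    and cancel directly.\<close>
  moreover have "shift_morphism \<epsilon> ?f a (?g a y) = internal_shift (2 * \<epsilon>) N a y"
    if y: "y \<in> carrier (pt N a)" for a y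
    using morphism_closed[OF g y] fg[OF y]
    by (simp add: shift_morphism_def internal_shift_def pq)
  ultimately show ?thesis
    unfolding interleaved_def by blast
qed

section \<open>Direct sums\<close>

lemma shift_direct_sum: "shift \<epsilon> (direct_sum I F) = direct_sum I (\<lambda>i. shift \<epsilon> (F i))"
  by (simp add: shift_def direct_sum_def)

lemma carrier_direct_sum:
  "x \<in> carrier (pt (direct_sum I F) a) \<longleftrightarrow>
     x \<in> (\<Pi>\<^sub>E i\<in>I. carrier (pt (F i) a)) \<and> finite {i \<in> I. x i \<noteq> \<zero>\<^bsub>pt (F i) a\<^esub>}"
  by (simp add: direct_sum_def direct_sum_space_def)

lemma carrier_direct_sum_component:
  "x \<in> carrier (pt (direct_sum I F) a) \<Longrightarrow> i \<in> I \<Longrightarrow> x i \<in> carrier (pt (F i) a)"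
  by (auto simp: carrier_direct_sum)

text \<open>A matrix of maps with at most one nonzero entry per row, so no sums arise. The matching
  \<tau> points backwards, from target to source index, because each target coordinate must know
  where to read; hence \<open>h\<close> is indexed by the target alone.\<close>

definition matched_sum_map ::
  "'j set \<Rightarrow> ('j \<Rightarrow> ('n::finite, 'k, 'w) pmod) \<Rightarrow> ('j \<rightharpoonup> 'i) \<Rightarrow> ('j \<Rightarrow> real ^ 'n \<Rightarrow> 'v \<Rightarrow> 'w) \<Rightarrow>
     real ^ 'n \<Rightarrow> ('i \<Rightarrow> 'v) \<Rightarrow> 'j \<Rightarrow> 'w" where
  "matched_sum_map J G \<tau> h a x =
     (\<lambda>j\<in>J. case \<tau> j of None \<Rightarrow> \<zero>\<^bsub>pt (G j) a\<^esub> | Some i \<Rightarrow> h j a (x i))"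

text \<open>Linearity and naturality hold coordinatewise. Injectivity of \<tau> serves finite
  support: a source coordinate feeds at most one target coordinate.\<close>

lemma morphism_matched_sum_map:
  assumes F: "\<And>i. i \<in> I \<Longrightarrow> indexed_module K (F i)"
    and G: "\<And>j. j \<in> J \<Longrightarrow> indexed_module K (G j)"
    and ran: "\<And>i j. \<tau> j = Some i \<Longrightarrow> i \<in> I"
    and inj: "\<And>i j j'. \<tau> j = Some i \<Longrightarrow> \<tau> j' = Some i \<Longrightarrow> j = j'"
    and h: "\<And>i j. \<tau> j = Some i \<Longrightarrow> morphism K (F i) (G j) (h j)"
  shows "morphism K (direct_sum I F) (direct_sum J G) (matched_sum_map J G \<tau> h)"
proof -
  have mF: "Module.module K (pt (F i) a)" if "i \<in> I" for i a
    using F[OF that] by (simp add: indexed_module_def)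
  have mG: "Module.module K (pt (G j) a)" if "j \<in> J" for j a
    using G[OF that] by (simp add: indexed_module_def)
  have h0: "h j a \<zero>\<^bsub>pt (F i) a\<^esub> = \<zero>\<^bsub>pt (G j) a\<^esub>" if "\<tau> j = Some i" "j \<in> J" for i j a
    using linear_maps_zero[OF mF[OF ran[OF that(1)]] mG[OF that(2)] morphism_linear[OF h[OF that(1)]]] .
  have G0: "\<zero>\<^bsub>pt (G j) a\<^esub> \<in> carrier (pt (G j) a)"
    "\<zero>\<^bsub>pt (G j) a\<^esub> \<oplus>\<^bsub>pt (G j) a\<^esub> \<zero>\<^bsub>pt (G j) a\<^esub> = \<zero>\<^bsub>pt (G j) a\<^esub>"
    "c \<in> carrier K \<Longrightarrow> c \<odot>\<^bsub>pt (G j) a\<^esub> \<zero>\<^bsub>pt (G j) a\<^esub> = \<zero>\<^bsub>pt (G j) a\<^esub>" if "j \<in> J" for j a c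
  proof -
    interpret Module.module K "pt (G j) a" by (rule mG[OF that])
    show "\<zero>\<^bsub>pt (G j) a\<^esub> \<in> carrier (pt (G j) a)"
      "\<zero>\<^bsub>pt (G j) a\<^esub> \<oplus>\<^bsub>pt (G j) a\<^esub> \<zero>\<^bsub>pt (G j) a\<^esub> = \<zero>\<^bsub>pt (G j) a\<^esub>"
      "c \<in> carrier K \<Longrightarrow> c \<odot>\<^bsub>pt (G j) a\<^esub> \<zero>\<^bsub>pt (G j) a\<^esub> = \<zero>\<^bsub>pt (G j) a\<^esub>"
      by (auto simp: smult_r_null)
  qed
  have G0_imap: "imap (G j) a b \<zero>\<^bsub>pt (G j) a\<^esub> = \<zero>\<^bsub>pt (G j) b\<^esub>" if "j \<in> J" "a \<le> b" for j a b
    using linear_maps_zero[OF mG mG] G that unfolding indexed_module_def by blast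
  have closed: "matched_sum_map J G \<tau> h a x \<in> carrier (pt (direct_sum J G) a)"
    if x: "x \<in> carrier (pt (direct_sum I F) a)" for a x
  proof -
    let ?S = "{i \<in> I. x i \<noteq> \<zero>\<^bsub>pt (F i) a\<^esub>}"
    have "finite ?S"
      using x by (simp add: carrier_direct_sum)
    then have "finite {j. \<exists>i\<in>?S. \<tau> j = Some i}"
    proof (rule finite_surj)
      \<comment> \<open>\<open>THE\<close> inverts \<tau> on its range. Its value at other
        \<open>i\<close> is arbitrary but harmless, since only an inclusion is claimed.\<close>
      show "{j. \<exists>i\<in>?S. \<tau> j = Some i} \<subseteq> (\<lambda>i. THE j. \<tau> j = Some i) ` ?S"
      proof safe
        fix i j assume "\<tau> j = Some i" "i \<in> I" "x i \<noteq> \<zero>\<^bsub>pt (F i) a\<^esub>"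
        then show "j \<in> (\<lambda>i. THE j. \<tau> j = Some i) ` ?S"
          using inj by (intro image_eqI[of _ _ i]) (auto intro: the_equality[symmetric])
      qed
    qed
    \<comment> \<open>A nonzero target coordinate is matched and, by \<open>h0\<close>, reads a
      nonzero source coordinate.\<close>
    moreover have "{j \<in> J. matched_sum_map J G \<tau> h a x j \<noteq> \<zero>\<^bsub>pt (G j) a\<^esub>} \<subseteq>
        {j. \<exists>i\<in>?S. \<tau> j = Some i}"
      using h0 ran by (fastforce simp: matched_sum_map_def split: option.splits)
    ultimately have "finite {j \<in> J. matched_sum_map J G \<tau> h a x j \<noteq> \<zero>\<^bsub>pt (G j) a\<^esub>}"
      by (rule finite_subset[rotated])
    moreover have "matched_sum_map J G \<tau> h a x \<in> (\<Pi>\<^sub>E j\<in>J. carrier (pt (G j) a))"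
      using x G0(1) morphism_closed[OF h] ran carrier_direct_sum_component[OF x]
      by (auto simp: matched_sum_map_def split: option.splits)
    ultimately show ?thesis
      by (simp add: carrier_direct_sum)
  qed
  have linear: "matched_sum_map J G \<tau> h a \<in>
      linear_maps K (pt (direct_sum I F) a) (pt (direct_sum J G) a)" for a
    unfolding linear_maps_def
  proof (intro CollectI conjI ballI)
    show "matched_sum_map J G \<tau> h a \<in>
        carrier (pt (direct_sum I F) a) \<rightarrow> carrier (pt (direct_sum J G) a)"
      using closed by blast
  next
    fix x y assume x: "x \<in> carrier (pt (direct_sum I F) a)"
      and y: "y \<in> carrier (pt (direct_sum I F) a)"
    show "matched_sum_map J G \<tau> h a (x \<oplus>\<^bsub>pt (direct_sum I F) a\<^esub> y) =
        matched_sum_map J G \<tau> h a x \<oplus>\<^bsub>pt (direct_sum J G) a\<^esub> matched_sum_map J G \<tau> h a y"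
      using ran G0(2) linear_maps_add[OF morphism_linear[OF h]]
        carrier_direct_sum_component[OF x] carrier_direct_sum_component[OF y]
      by (auto simp: fun_eq_iff matched_sum_map_def direct_sum_def direct_sum_space_def
          split: option.splits)
  next
    fix c x assume c: "c \<in> carrier K" and x: "x \<in> carrier (pt (direct_sum I F) a)"
    show "matched_sum_map J G \<tau> h a (c \<odot>\<^bsub>pt (direct_sum I F) a\<^esub> x) =
        c \<odot>\<^bsub>pt (direct_sum J G) a\<^esub> matched_sum_map J G \<tau> h a x"
      using ran G0(3)[OF _ c] linear_maps_smult[OF morphism_linear[OF h] c]
        carrier_direct_sum_component[OF x]
      by (auto simp: fun_eq_iff matched_sum_map_def direct_sum_def direct_sum_space_def
          split: option.splits)
  qed
  have "matched_sum_map J G \<tau> h b (imap (direct_sum I F) a b x) =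
      imap (direct_sum J G) a b (matched_sum_map J G \<tau> h a x)"
    if "a \<le> b" "x \<in> carrier (pt (direct_sum I F) a)" for a b x
    \<comment> \<open>\<open>G0_imap\<close> settles the unmatched coordinates,
      \<open>morphism_natural\<close> the matched ones.\<close>
    using that ran G0_imap morphism_natural[OF h] carrier_direct_sum_component[OF that(2)]
    by (auto simp: fun_eq_iff matched_sum_map_def direct_sum_def split: option.splits)
  with linear show ?thesis
    unfolding morphism_def by blast
qed

text \<open>A matched coordinate \<open>i\<close> is sent to its partner and back to
  \<open>i\<close>, where \<open>gf\<close> applies; an unmatched one is zero on both sides. The
  statement covers one composite; the other follows by exchanging the roles of \<sigma> and
  \<tau>.\<close>

lemma matched_sum_map_comp:
  assumes \<sigma>\<tau>: "\<And>i j. \<sigma> i = Some j \<Longrightarrow> \<tau> j = Some i" and ran: "\<And>i j. \<sigma> i = Some j \<Longrightarrow> j \<in> J"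
    and triv: "\<And>i. i \<in> I \<Longrightarrow> \<sigma> i = None \<Longrightarrow> trivial_module (2 * \<epsilon>) (F i)"
    and gf: "\<And>i j a x. \<sigma> i = Some j \<Longrightarrow> x \<in> carrier (pt (F i) a) \<Longrightarrow>
      shift_morphism \<epsilon> (g i) a (f j a x) = internal_shift (2 * \<epsilon>) (F i) a x"
    and x: "x \<in> carrier (pt (direct_sum I F) a)"
  shows "shift_morphism \<epsilon> (matched_sum_map I (\<lambda>i. shift \<epsilon> (F i)) \<sigma> g) a
      (matched_sum_map J (\<lambda>j. shift \<epsilon> (G j)) \<tau> f a x) =
    internal_shift (2 * \<epsilon>) (direct_sum I F) a x"
proof
  fix i
  show "shift_morphism \<epsilon> (matched_sum_map I (\<lambda>i. shift \<epsilon> (F i)) \<sigma> g) a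
      (matched_sum_map J (\<lambda>j. shift \<epsilon> (G j)) \<tau> f a x) i =
    internal_shift (2 * \<epsilon>) (direct_sum I F) a x i"
  proof (cases "i \<in> I")
    case True
    note xi = carrier_direct_sum_component[OF x True]
    show ?thesis
    proof (cases "\<sigma> i")
      case None
      \<comment> \<open>The default value is the zero of \<open>F i\<close> at the twice shifted
        index, which is the one in \<open>trivial_module\<close> after rewriting.\<close>
      with triv[OF True] xi True show ?thesis
        by (simp add: shift_morphism_def matched_sum_map_def internal_shift_def direct_sum_def
            trivial_module_def add_scaleR_1_twice)
    next
      case (Some j)
      with \<sigma>\<tau>[OF Some] ran[OF Some] gf[OF Some xi] True show ?thesis
        by (simp add: shift_morphism_def matched_sum_map_def internal_shift_def direct_sum_def)
    qed
  \<comment> \<open>Outside \<open>I\<close> both sides are \<open>undefined\<close>, being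
    restricted functions.\<close>
  qed (simp add: shift_morphism_def matched_sum_map_def internal_shift_def direct_sum_def)
qed

lemma interleaved_direct_sum:
  assumes F: "\<And>i. i \<in> I \<Longrightarrow> indexed_module K (F i)"
    and G: "\<And>j. j \<in> J \<Longrightarrow> indexed_module K (G j)"
    and \<sigma>: "dom \<sigma> \<subseteq> I" "ran \<sigma> \<subseteq> J" "inj_on \<sigma> (dom \<sigma>)"
    and F_triv: "\<And>i. i \<in> I - dom \<sigma> \<Longrightarrow> trivial_module (2 * \<epsilon>) (F i)"
    and G_triv: "\<And>j. j \<in> J - ran \<sigma> \<Longrightarrow> trivial_module (2 * \<epsilon>) (G j)"
    and matched: "\<And>i j. \<sigma> i = Some j \<Longrightarrow> interleaved K \<epsilon> (F i) (G j)"
  shows "interleaved K \<epsilon> (direct_sum I F) (direct_sum J G)"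
proof -
  \<comment> \<open>The partial inverse of \<sigma>, needed because the two morphisms read the
    matching in opposite directions.\<close>
  define \<tau> where "\<tau> j = (if j \<in> ran \<sigma> then Some (THE i. \<sigma> i = Some j) else None)" for j
  have inj: "i = i'" if "\<sigma> i = Some j" "\<sigma> i' = Some j" for i i' j
    using \<sigma>(3) that unfolding inj_on_def by (metis domI)
  have \<tau>: "\<tau> j = Some i \<longleftrightarrow> \<sigma> i = Some j" for i j
  proof -
    have the: "(THE i. \<sigma> i = Some j) = i'" if "\<sigma> i' = Some j" for i'
      using that inj by blast
    show ?thesis
    proof (cases "j \<in> ran \<sigma>")
      case True
      then obtain i' where "\<sigma> i' = Some j"
        by (auto simp: ran_def)
      with the inj show ?thesis
        by (auto simp: \<tau>_def intro: ranI)
    qed (auto simp: \<tau>_def intro: ranI)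
  qed
  have \<tau>_None: "\<tau> j = None \<longleftrightarrow> j \<notin> ran \<sigma>" for j
    by (simp add: \<tau>_def)
  \<comment> \<open>Unfolded for all matched pairs at once, so that the axiom of choice yields
    families \<open>f i j\<close> and \<open>g i j\<close>.\<close>
  have "\<exists>f g. morphism K (F i) (shift \<epsilon> (G j)) f \<and> morphism K (G j) (shift \<epsilon> (F i)) g \<and>
     (\<forall>a. \<forall>x\<in>carrier (pt (F i) a). shift_morphism \<epsilon> g a (f a x) = internal_shift (2 * \<epsilon>) (F i) a x) \<and>
     (\<forall>a. \<forall>y\<in>carrier (pt (G j) a). shift_morphism \<epsilon> f a (g a y) = internal_shift (2 * \<epsilon>) (G j) a y)"
    if "\<sigma> i = Some j" for i j
    using matched[OF that] by (simp add: interleaved_def)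
  then obtain f g where
    f: "\<And>i j. \<sigma> i = Some j \<Longrightarrow> morphism K (F i) (shift \<epsilon> (G j)) (f i j)" and
    g: "\<And>i j. \<sigma> i = Some j \<Longrightarrow> morphism K (G j) (shift \<epsilon> (F i)) (g i j)" and
    gf: "\<And>i j a x. \<sigma> i = Some j \<Longrightarrow> x \<in> carrier (pt (F i) a) \<Longrightarrow>
      shift_morphism \<epsilon> (g i j) a (f i j a x) = internal_shift (2 * \<epsilon>) (F i) a x" and
    fg: "\<And>i j a y. \<sigma> i = Some j \<Longrightarrow> y \<in> carrier (pt (G j) a) \<Longrightarrow>
      shift_morphism \<epsilon> (f i j) a (g i j a y) = internal_shift (2 * \<epsilon>) (G j) a y"
    by metis
  \<comment> \<open>\<open>matched_sum_map\<close> wants families indexed by the target, so the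
    source index is recovered from the matching. Values at unmatched indices are arbitrary and never
    read.\<close>
  define f' where "f' j = f (the (\<tau> j)) j" for j
  define g' where "g' i = g i (the (\<sigma> i))" for i
  have f'_g'[simp]: "f' j = f i j" "g' i = g i j" if "\<sigma> i = Some j" for i j
    using that \<tau>[of j i] by (simp_all add: f'_def g'_def)
  let ?f = "matched_sum_map J (\<lambda>j. shift \<epsilon> (G j)) \<tau> f'"
  let ?g = "matched_sum_map I (\<lambda>i. shift \<epsilon> (F i)) \<sigma> g'"
  have "morphism K (direct_sum I F) (shift \<epsilon> (direct_sum J G)) ?f"
    unfolding shift_direct_sum
    \<comment> \<open>Injectivity of \<tau> holds because \<sigma> is single-valued; for
      \<open>?g\<close> below, what is needed is injectivity of \<sigma> itself.\<close>
    using \<sigma> F G f by (intro morphism_matched_sum_map) (auto simp: \<tau> indexed_module_shift)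
  moreover have "morphism K (direct_sum J G) (shift \<epsilon> (direct_sum I F)) ?g"
    unfolding shift_direct_sum
    using \<sigma> F G g inj
    by (intro morphism_matched_sum_map) (auto simp: indexed_module_shift intro: ranI)
  moreover have "shift_morphism \<epsilon> ?g a (?f a x) = internal_shift (2 * \<epsilon>) (direct_sum I F) a x"
    if "x \<in> carrier (pt (direct_sum I F) a)" for a x
  proof (rule matched_sum_map_comp[OF _ _ _ _ that])
    show "trivial_module (2 * \<epsilon>) (F i)" if "i \<in> I" "\<sigma> i = None" for i
      using F_triv[of i] that by (simp add: domIff)
    show "j \<in> J" if "\<sigma> i = Some j" for i j
      using \<sigma>(2) that by (auto intro: ranI)
  qed (simp_all add: \<tau> gf)
  moreover have "shift_morphism \<epsilon> ?f a (?g a y) = internal_shift (2 * \<epsilon>) (direct_sum J G) a y"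
    if "y \<in> carrier (pt (direct_sum J G) a)" for a y
    using \<sigma> G_triv fg that
    by (intro matched_sum_map_comp) (auto simp: \<tau> \<tau>_None)
  ultimately show ?thesis
    unfolding interleaved_def by blast
qed

section \<open>Interval modules\<close>

text \<open>Convexity gives functoriality: if \<open>a\<close> and \<open>c\<close> lie in
  \<open>J\<close>, the map between them is the identity, so its factorization through an
  intermediate \<open>b\<close> must not vanish.\<close>

lemma indexed_module_interval_module:
  assumes "field K" "poset_convex J"
  shows "indexed_module K (interval_module K J)"
proof -
  interpret field K by fact
  have module: "Module.module K (pt (interval_module K J) a)" for a
  proof (rule moduleI)
    show "abelian_group (pt (interval_module K J) a)"
    proof (rule abelian_groupI)
      \<comment> \<open>The negative taken in \<open>K\<close> works for both possible carriers,
        since it fixes zero.\<close>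
      fix x assume "x \<in> carrier (pt (interval_module K J) a)"
      then have "\<ominus>\<^bsub>K\<^esub> x \<in> carrier (pt (interval_module K J) a)" "\<ominus>\<^bsub>K\<^esub> x \<oplus>\<^bsub>K\<^esub> x = \<zero>\<^bsub>K\<^esub>"
        by (auto simp: interval_module_def l_neg split: if_splits)
      then show "\<exists>y\<in>carrier (pt (interval_module K J) a).
          y \<oplus>\<^bsub>pt (interval_module K J) a\<^esub> x = \<zero>\<^bsub>pt (interval_module K J) a\<^esub>"
        by (intro bexI[of _ "\<ominus>\<^bsub>K\<^esub> x"]) (simp_all add: interval_module_def)
    qed (simp_all add: interval_module_def a_assoc a_comm a_lcomm split: if_splits)
  qed (auto simp: interval_module_def is_cring l_distr r_distr m_assoc split: if_splits)
  have "imap (interval_module K J) b c (imap (interval_module K J) a b x) =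
      imap (interval_module K J) a c x"
    if "a \<le> b" "b \<le> c" for a b c x
  proof -
    have "b \<in> J" if "a \<in> J" "c \<in> J"
      using assms(2) that \<open>a \<le> b\<close> \<open>b \<le> c\<close> unfolding poset_convex_def by blast
    then show ?thesis
      by (simp add: interval_module_def)
  qed
  with module show ?thesis
    unfolding indexed_module_def linear_maps_def by (auto simp: interval_module_def)
qed

theorem proposition2p12:
  fixes K :: "('k, 'm) ring_scheme"
    and M :: "('n::finite, 'k, 'v) pmod" and N :: "('n, 'k, 'w) pmod"
    and BM :: "('i, real ^ 'n) set_multiset" and BN :: "('j, real ^ 'n) set_multiset"
  assumes "field K"
    and "indexed_module K M" and "indexed_module K N"
    and "has_barcode K M BM" and "has_barcode K N BN"
  shows "(\<forall>\<epsilon>\<ge>0. (\<exists>\<sigma>. eps_matching K \<epsilon> BM BN \<sigma>) \<longrightarrow> interleaved K \<epsilon> M N) \<and>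
         interleaving_distance K M N \<le> bottleneck_distance K BM BN"
proof -
  have *: "interleaved K \<epsilon> M N" if "0 \<le> \<epsilon>" and \<sigma>: "eps_matching K \<epsilon> BM BN \<sigma>" for \<epsilon> \<sigma>
  proof -
    let ?SM = "direct_sum (idx BM) (\<lambda>i. interval_module K (bar BM i))"
    let ?SN = "direct_sum (idx BN) (\<lambda>j. interval_module K (bar BN j))"
    have "interleaved K \<epsilon> ?SM ?SN"
    proof (rule interleaved_direct_sum[where \<sigma> = \<sigma>])
      show "indexed_module K (interval_module K (bar BM i))" if "i \<in> idx BM" for i
        using that assms by (intro indexed_module_interval_module)
          (auto simp: has_barcode_def poset_interval_def)
      show "indexed_module K (interval_module K (bar BN j))" if "j \<in> idx BN" for j
        using that assms by (intro indexed_module_interval_module)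
          (auto simp: has_barcode_def poset_interval_def)
    \<comment> \<open>Unmatched bars are trivial because the coimage and image of \<sigma> contain
      all nontrivial indices.\<close>
    qed (use \<sigma> in \<open>auto simp: eps_matching_def matching_def nontrivial_idx_def\<close>)
    then have "interleaved K \<epsilon> M ?SN"
      using assms(4) \<open>0 \<le> \<epsilon>\<close> interleaved_isomorphic_left by (auto simp: has_barcode_def)
    \<comment> \<open>Symmetry lets the left-hand transport lemma replace the right-hand module as
      well.\<close>
    then have "interleaved K \<epsilon> N M"
      using assms(5) \<open>0 \<le> \<epsilon>\<close> interleaved_isomorphic_left interleaved_sym
      unfolding has_barcode_def by blast
    then show ?thesis
      by (rule interleaved_sym)
  qed
  \<comment> \<open>The \<epsilon> admitting a matching form a subset of those admitting an
    interleaving, so the infimum over them is at least as large.\<close>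
  then show ?thesis
    unfolding interleaving_distance_def bottleneck_distance_def
    by (auto intro!: INF_superset_mono)
qed

end
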